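(* For any integers $q\ge p\ge 2$, $\bar{d}(K(2,p,q))=2$ if and only if $q\le \binom{p}{\lfloor p/2\rfloor}$.
   Context: $K(2,p,q)$ is the complete tripartite graph with partite sets of sizes $2$, $p$, $q$. For a connected bridgeless graph $G$, the orientation number $\bar d(G)$ is the minimum of the diameter $d(D)$ over all strong orientations $D$ of $G$ (orientations in which every two vertices are mutually reachable), where $d(D)$ is the maximum over ordered pairs of vertices of the length of a shortest directed path. *)

theory Defs
  imports "Graph_Theory.Graph_Theory"
begin

text \<open>
  Undirected graphs are, as in the library, symmetric digraphs: an edge \<open>uv\<close> is the pair of
  arcs \<open>(u, v)\<close>, \<open>(v, u)\<close>. The predicate below is the three-part analogue of
  \<^const>\<open>complete_bipartite_digraph\<close>.
\<close>

definition complete_tripartite_digraph ::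
    "nat \<Rightarrow> nat \<Rightarrow> nat \<Rightarrow> 'a pair_pre_digraph \<Rightarrow> bool" where
  "complete_tripartite_digraph l m n G \<longleftrightarrow> pair_graph G \<and>
    (\<exists>U V W. pverts G = U \<union> V \<union> W \<and> U \<inter> V = {} \<and> U \<inter> W = {} \<and> V \<inter> W = {}
      \<and> card U = l \<and> card V = m \<and> card W = n
      \<and> parcs G = U \<times> V \<union> V \<times> U \<union> U \<times> W \<union> W \<times> U \<union> V \<times> W \<union> W \<times> V)"

definition orientation_of :: "'a pair_pre_digraph \<Rightarrow> 'a pair_pre_digraph \<Rightarrow> bool" where
  "orientation_of D G \<longleftrightarrow> spanning (with_proj D) (with_proj G) \<and>
    (\<forall>(u, v) \<in> parcs G. ((u, v) \<in> parcs D) \<noteq> ((v, u) \<in> parcs D))"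

text \<open>
  With unit weights, \<open>\<mu>\<close> is the length of a shortest directed walk (equivalently, path), and it is
  \<open>\<infinity>\<close> if there is none.
\<close>

definition digraph_diameter :: "('a, 'b) pre_digraph \<Rightarrow> ereal" where
  "digraph_diameter D = (SUP (u, v) \<in> verts D \<times> verts D. wf_digraph.\<mu> D (\<lambda>_. 1) u v)"

text \<open>
  A finite graph has finitely many orientations, so the infimum is a minimum whenever a strong
  orientation exists, that is, for every finite connected bridgeless graph. It is \<open>\<infinity>\<close> for graphs
  without strong orientations.
\<close>

definition orientation_number :: "'a pair_pre_digraph \<Rightarrow> ereal" where
  "orientation_number G =
    (INF D \<in> {D. orientation_of D G \<and> strongly_connected (with_proj D)}.
      digraph_diameter (with_proj D))"

text \<open>Complete tripartite graphs of all sizes exist over any infinite vertex type.\<close>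

lemma complete_tripartite_digraph_exists:
  assumes "infinite (UNIV :: 'a set)"
  shows "\<exists>G :: 'a pair_pre_digraph. complete_tripartite_digraph l m n G"
proof -
  obtain U :: "'a set" where U: "finite U" "card U = l"
    using infinite_arbitrarily_large[OF assms] by blast
  have "infinite (UNIV - U)" using assms U by simp
  then obtain V where V: "finite V" "card V = m" "V \<subseteq> UNIV - U"
    using infinite_arbitrarily_large by blast
  have "infinite (UNIV - U - V)" using assms U V by simp
  then obtain W where W: "finite W" "card W = n" "W \<subseteq> UNIV - U - V"
    using infinite_arbitrarily_large by blast
  let ?G = "\<lparr>pverts = U \<union> V \<union> W,
    parcs = U \<times> V \<union> V \<times> U \<union> U \<times> W \<union> W \<times> U \<union> V \<times> W \<union> W \<times> V\<rparr>"
  have "pair_graph ?G"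
    using U V W by unfold_locales (auto simp: symmetric_def sym_def)
  moreover have "U \<inter> V = {}" "U \<inter> W = {}" "V \<inter> W = {}" using V W by auto
  ultimately have "complete_tripartite_digraph l m n ?G"
    unfolding complete_tripartite_digraph_def using U(2) V(2) W(2)
    by (intro conjI exI[of _ U] exI[of _ V] exI[of _ W]) simp_all
  then show ?thesis ..
qed

end

theory Submission
  imports Defs
begin

text \<open>
  Let \<open>{a, b}\<close>, \<open>V\<close>, \<open>W\<close> be the parts, with \<open>p\<close> vertices in \<open>V\<close> and \<open>q\<close> in \<open>W\<close>. In an orientation of
  diameter two the out-neighbourhoods of the vertices of \<open>W\<close> form an antichain. Since an arc between
  \<open>V\<close> and \<open>W\<close> can only be returned through \<open>a\<close> or \<open>b\<close>, if \<open>W\<close> has more than two vertices then, up to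
  exchanging \<open>a\<close> and \<open>b\<close>, all of them but at most one point to \<open>a\<close> and not to \<open>b\<close>; Sperner's theorem
  bounds these. If there is an exceptional vertex, some \<open>u \<in> V\<close> is joined in the same way to all
  the others, so that Sperner's theorem applies to \<open>V - {u}\<close>. Conversely, orient \<open>W \<rightarrow> a \<rightarrow> V \<rightarrow> b \<rightarrow> W\<close> and
  let the vertices of \<open>W\<close> point to distinct \<open>\<lfloor>p/2\<rfloor>\<close>-subsets of \<open>V\<close>, among them the cyclic intervals.
\<close>

section \<open>Sperner's theorem\<close>

text \<open>Averaging over one-point deletions: for each \<open>x\<close> the members of
  \<open>F\<close> that avoid \<open>x\<close> form an antichain in \<open>V - {x}\<close>, to which
  the induction hypothesis applies. Summed over all \<open>x\<close>, a member \<open>A\<close> is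
  counted \<open>card V - card A\<close> times.\<close>

lemma lubell_yamamoto_meshalkin:
  assumes "finite V" "F \<subseteq> Pow V" "\<And>A B. A \<in> F \<Longrightarrow> B \<in> F \<Longrightarrow> A \<subseteq> B \<Longrightarrow> A = B"
  shows "(\<Sum>A\<in>F. 1 / real (card V choose card A)) \<le> 1"
  using assms
proof (induction "card V" arbitrary: V F)
  case 0
  then have "F = {} \<or> F = {{}}" by auto
  then show ?case using 0 by auto
next
  case (Suc n)
  have finF: "finite F" using Suc.prems by (meson finite_Pow_iff finite_subset)
  show ?case
  \<comment> \<open>The set \<open>V\<close> avoids no point, so no deletion counts it; if it
    belongs to \<open>F\<close>, it is the only member.\<close>
  proof (cases "V \<in> F")
    case True
    then have "F = {V}" using Suc.prems by (auto dest: Suc.prems(3)[OF _ True])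
    then show ?thesis by simp
  next
    case False
    have less: "card A < Suc n" if "A \<in> F" for A
      using that False Suc.prems Suc.hyps(2) psubset_card_mono[of V A] by auto
    \<comment> \<open>The weights of \<open>A\<close> in row \<open>n\<close>, collected over its
      \<open>Suc n - card A\<close> deletions, amount to \<open>Suc n\<close> times its weight in
      row \<open>Suc n\<close>.\<close>
    have absorb: "(Suc n - real (card A)) / (n choose card A) = Suc n * (1 / (Suc n choose card A))"
      if "A \<in> F" for A
    proof -
      have "real ((Suc n - card A) * (Suc n choose card A)) = real (Suc n * (n choose card A))"
        using binomial_absorb_comp[of "Suc n" "card A"] by simp
      then have "(Suc n - real (card A)) * (Suc n choose card A) = Suc n * (n choose card A)"
        using less[OF that] by (simp add: of_nat_diff)
      moreover have "(Suc n choose card A) > 0" "(n choose card A) > 0"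
        using less[OF that] by (simp_all add: zero_less_binomial_iff)
      ultimately show ?thesis by (simp add: field_simps)
    qed
    have "Suc n * (\<Sum>A\<in>F. 1 / real (Suc n choose card A))
        = (\<Sum>A\<in>F. (Suc n - real (card A)) / (n choose card A))"
      by (subst sum_distrib_left) (intro sum.cong refl absorb[symmetric])
    also have "\<dots> = (\<Sum>A\<in>F. \<Sum>x\<in>V - A. 1 / real (n choose card A))"
    proof (intro sum.cong refl)
      fix A assume "A \<in> F"
      then have "card (V - A) = Suc n - card A" "card A \<le> Suc n"
        using Suc.prems Suc.hyps(2) less[of A] by (auto simp: card_Diff_subset finite_subset)
      then show "(Suc n - real (card A)) / (n choose card A) = (\<Sum>x\<in>V - A. 1 / real (n choose card A))"
        by (simp add: of_nat_diff)
    qed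
    also have "\<dots> = (\<Sum>A\<in>F. \<Sum>x | x \<in> V \<and> x \<notin> A. 1 / real (n choose card A))"
      by (simp add: set_diff_eq)
    also have "\<dots> = (\<Sum>x\<in>V. \<Sum>A | A \<in> F \<and> x \<notin> A. 1 / real (n choose card A))"
      using finF Suc.prems(1) by (rule sum.swap_restrict)
    also have "\<dots> \<le> (\<Sum>x\<in>V. 1)"
    proof (rule sum_mono)
      fix x assume "x \<in> V"
      then have n: "n = card (V - {x})" using Suc.hyps(2) Suc.prems(1) by simp
      show "(\<Sum>A | A \<in> F \<and> x \<notin> A. 1 / real (n choose card A)) \<le> 1"
        using Suc.hyps(1)[OF n, of "{A \<in> F. x \<notin> A}"] Suc.prems n by auto
    qed
    also have "\<dots> = real (Suc n) * 1" using Suc.hyps(2) by simp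
    finally have "real (Suc n) * (\<Sum>A\<in>F. 1 / real (Suc n choose card A)) \<le> real (Suc n) * 1" .
    then have "(\<Sum>A\<in>F. 1 / real (Suc n choose card A)) \<le> 1"
      by (rule mult_left_le_imp_le) simp
    then show ?thesis using Suc.hyps(2) by simp
  qed
qed

text \<open>The central coefficient is the largest in its row, so each term of the preceding sum is
  at least \<open>1 / M\<close>.\<close>

theorem sperner:
  assumes "finite V" "F \<subseteq> Pow V" "\<And>A B. A \<in> F \<Longrightarrow> B \<in> F \<Longrightarrow> A \<subseteq> B \<Longrightarrow> A = B"
  shows "card F \<le> card V choose (card V div 2)"
proof -
  define M where "M = card V choose (card V div 2)"
  have "M > 0" by (simp add: M_def zero_less_binomial_iff)
  have "card F / M = (\<Sum>A\<in>F. 1 / real M)" by simp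
  also have "\<dots> \<le> (\<Sum>A\<in>F. 1 / real (card V choose card A))"
  proof (rule sum_mono)
    fix A assume "A \<in> F"
    then have "card A \<le> card V" using assms by (auto intro: card_mono)
    then show "1 / real M \<le> 1 / real (card V choose card A)"
      unfolding M_def
      by (intro divide_left_mono) (simp_all add: binomial_maximum zero_less_binomial_iff)
  qed
  also have "\<dots> \<le> 1" using assms by (rule lubell_yamamoto_meshalkin)
  finally show ?thesis using \<open>M > 0\<close> by (simp add: M_def field_simps)
qed

text \<open>The last hypothesis makes \<open>f\<close> injective and its image an antichain at once,
  so the bound passes from sets to the vertices that index them.\<close>

corollary sperner_indexed:
  assumes "finite V" "\<And>x. x \<in> W \<Longrightarrow> f x \<subseteq> V"
    "\<And>x y. x \<in> W \<Longrightarrow> y \<in> W \<Longrightarrow> f x \<subseteq> f y \<Longrightarrow> x = y"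
  shows "card W \<le> card V choose (card V div 2)"
proof -
  have "inj_on f W" using assms(3) by (auto intro: inj_onI)
  then have "card W = card (f ` W)" by (simp add: card_image)
  also have "\<dots> \<le> card V choose (card V div 2)"
    using assms by (intro sperner) auto
  finally show ?thesis .
qed

text \<open>Pascal's rule splits the central coefficient of row \<open>p\<close> into two positive
  neighbours in row \<open>p - 1\<close>, one of them central there. The spare 1 pays for an
  exceptional vertex of \<open>W\<close> when Sperner's bound is applied to one point fewer.\<close>

lemma Suc_central_binomial_le:
  assumes "2 \<le> p"
  shows "Suc ((p - 1) choose ((p - 1) div 2)) \<le> p choose (p div 2)"
proof -
  obtain n where p: "p = Suc n" and n: "n \<ge> 1" using assms by (cases p) auto
  define k where "k = p div 2 - 1"
  have k: "p div 2 = Suc k" using assms by (simp add: k_def)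
  have pos: "n choose k > 0" "n choose Suc k > 0"
    using k n p by (auto simp: zero_less_binomial_iff)
  have "n div 2 = k \<or> n div 2 = Suc k" using k p by presburger
  then have "n choose (n div 2) = n choose k \<or> n choose (n div 2) = n choose Suc k" by auto
  moreover have "p choose (p div 2) = (n choose k) + (n choose Suc k)"
    unfolding k unfolding p by simp
  moreover have "p - 1 = n" using p by simp
  ultimately show ?thesis using pos by (simp only:) linarith
qed

section \<open>A separating family in the middle layer\<close>

text \<open>The cyclic intervals of length \<open>m\<close>: two of them have \<open>u\<close> as first, respectively last element,
  and meet only in \<open>u\<close> when \<open>m\<close> is at most half of the cycle.\<close>

lemma cyclic_intervals_separate:
  fixes m p :: nat
  assumes "0 < m" "2 * m \<le> p" "u < p" "v < p" "u \<noteq> v"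
  obtains i where "i < p" "\<exists>j<m. u = (i + j) mod p" "\<nexists>j. j < m \<and> v = (i + j) mod p"
proof -
  define e where "e = m - 1"
  \<comment> \<open>The start of the interval whose last element is \<open>u\<close>; adding
    \<open>p\<close> keeps the subtraction from truncating.\<close>
  define i where "i = (u + p - e) mod p"
  have e: "e < m" "2 * e < p" using assms by (auto simp: e_def)
  have le_e: "j < m \<Longrightarrow> j \<le> e" for j by (simp add: e_def)
  have "i < p" using assms by (simp add: i_def)
  have start: "u = (u + 0) mod p" using assms by simp
  have "(i + e) mod p = (u + p - e + e) mod p" by (simp only: i_def mod_add_left_eq)
  then have stop: "u = (i + e) mod p" using assms e by simp
  \<comment> \<open>A point in both intervals would lie at most \<open>e\<close> steps after
    \<open>u\<close> and at most \<open>e\<close> steps before it; as \<open>2 * e < p\<close>, only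
    \<open>u\<close> does. Hence one of the two intervals misses \<open>v\<close>.\<close>
  have "\<not> ((\<exists>j<m. v = (u + j) mod p) \<and> (\<exists>k<m. v = (i + k) mod p))"
  proof
    assume "(\<exists>j<m. v = (u + j) mod p) \<and> (\<exists>k<m. v = (i + k) mod p)"
    then obtain j k where jk: "j \<le> e" "k \<le> e" "v = (u + j) mod p" "v = (i + k) mod p"
      using le_e by blast
    have "v = (if u + j < p then u + j else u + j - p)"
      using jk e assms by (simp add: mod_if)
    moreover have "v = (u + p - e + k) mod p"
      unfolding jk(4) i_def by (simp only: mod_add_left_eq)
    then have "v = (if u + p - e + k < p then u + p - e + k else u + p - e + k - p)"
      using jk e assms by (subst (asm) mod_if, subst (asm) mod_less) auto
    ultimately show False using jk e assms by (auto split: if_splits)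
  qed
  then show thesis
    using that[of u] that[of i] start stop \<open>i < p\<close> e assms by blast
qed

text \<open>The cyclic intervals along an enumeration of \<open>V\<close> already separate its
  points. There are at most \<open>p \<le> q\<close> of them, and separation survives enlarging the
  family to size \<open>q\<close> inside the layer.\<close>

lemma separating_middle_layer_family:
  assumes "finite V" "card V = p" "2 \<le> p" "p \<le> q" "q \<le> p choose (p div 2)"
  shows "\<exists>F \<subseteq> {S. S \<subseteq> V \<and> card S = p div 2}. card F = q
    \<and> (\<forall>u\<in>V. \<forall>v\<in>V. u \<noteq> v \<longrightarrow> (\<exists>S\<in>F. u \<in> S \<and> v \<notin> S))"
proof -
  define m where "m = p div 2"
  have m: "0 < m" "2 * m \<le> p" using assms by (auto simp: m_def)
  obtain h where h: "bij_betw h {0..<p} V"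
    using ex_bij_betw_nat_finite[OF assms(1)] assms(2) by auto
  define S where "S i = (\<lambda>j. h ((i + j) mod p)) ` {..<m}" for i
  have inj: "inj_on (\<lambda>j. h ((i + j) mod p)) {..<m}" if "i < p" for i
  proof (rule inj_onI)
    fix j k assume jk: "j \<in> {..<m}" "k \<in> {..<m}" "h ((i + j) mod p) = h ((i + k) mod p)"
    then have "(i + j) mod p = (i + k) mod p"
      using h m assms by (auto simp: bij_betw_def inj_on_def)
    then show "j = k" using jk m that by (auto simp: mod_if split: if_splits)
  qed
  have S: "S i \<subseteq> V" "card (S i) = m" if "i < p" for i
    using h inj[OF that] m assms by (auto simp: S_def card_image bij_betw_def)
  let ?L = "{S. S \<subseteq> V \<and> card S = p div 2}"
  have L: "finite ?L" "card ?L = p choose (p div 2)"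
    using n_subsets[of V "p div 2"] assms by auto
  have "card (S ` {..<p}) \<le> q"
    using card_image_le[of "{..<p}" S] assms by simp
  moreover have "S ` {..<p} \<subseteq> ?L" using S by (auto simp: m_def)
  ultimately obtain F where F: "S ` {..<p} \<subseteq> F" "F \<subseteq> ?L" "card F = q"
    using exists_subset_between[of "S ` {..<p}" q ?L] L assms by auto
  have "\<exists>S\<in>F. u \<in> S \<and> v \<notin> S" if uv: "u \<in> V" "v \<in> V" "u \<noteq> v" for u v
  proof -
    obtain u' v' where uv': "u' < p" "v' < p" "u = h u'" "v = h v'"
      using uv h unfolding bij_betw_def by (metis (no_types, lifting) atLeastLessThan_iff imageE)
    then have "u' \<noteq> v'" using uv by auto
    obtain i where i: "i < p" "\<exists>j<m. u' = (i + j) mod p" "\<nexists>j. j < m \<and> v' = (i + j) mod p"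
      using cyclic_intervals_separate[OF m uv'(1,2) \<open>u' \<noteq> v'\<close>] .
    have "u \<in> S i" using i uv' by (auto simp: S_def)
    moreover have "v \<notin> S i"
      using i uv' h assms by (auto simp: S_def bij_betw_def inj_on_def)
    ultimately show ?thesis using F i by blast
  qed
  then show ?thesis using F(2,3) by (intro exI[of _ F]) simp
qed

section \<open>The two-vertex part and the upper bound\<close>

text \<open>An orientation of diameter two of the graph with parts \<open>{a, b}\<close>, \<open>V\<close>, \<open>W\<close>: \<open>A x\<close> and \<open>B x\<close>
  stand for the arcs from \<open>x\<close> to \<open>a\<close> and to \<open>b\<close>, and \<open>T x v\<close> for the arc from \<open>x \<in> W\<close> to
  \<open>v \<in> V\<close>; negation reverses the arc.\<close>

locale short_tripartite =
  fixes A B :: "'a \<Rightarrow> bool" and V W :: "'a set" and T :: "'a \<Rightarrow> 'a \<Rightarrow> bool"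
  assumes finite_V: "finite V" and finite_W: "finite W" and card_V: "2 \<le> card V"
    and to_V: "x \<in> W \<Longrightarrow> v \<in> V \<Longrightarrow> T x v \<Longrightarrow> A v \<and> \<not> A x \<or> B v \<and> \<not> B x"
    and to_W: "x \<in> W \<Longrightarrow> v \<in> V \<Longrightarrow> \<not> T x v \<Longrightarrow> A x \<and> \<not> A v \<or> B x \<and> \<not> B v"
    and sep_W: "x \<in> W \<Longrightarrow> y \<in> W \<Longrightarrow> x \<noteq> y \<Longrightarrow>
      A x \<and> \<not> A y \<or> B x \<and> \<not> B y \<or> (\<exists>v\<in>V. T x v \<and> \<not> T y v)"
    and sep_V: "u \<in> V \<Longrightarrow> v \<in> V \<Longrightarrow> u \<noteq> v \<Longrightarrow>
      A u \<and> \<not> A v \<or> B u \<and> \<not> B v \<or> (\<exists>x\<in>W. \<not> T x u \<and> T x v)"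
    and from_a: "x \<in> W \<Longrightarrow> A x \<Longrightarrow> \<exists>v\<in>V. \<not> A v \<and> \<not> T x v"
    and from_b: "x \<in> W \<Longrightarrow> B x \<Longrightarrow> \<exists>v\<in>V. \<not> B v \<and> \<not> T x v"
    and to_a: "x \<in> W \<Longrightarrow> \<not> A x \<Longrightarrow> \<exists>v\<in>V. A v \<and> T x v"
    and to_b: "x \<in> W \<Longrightarrow> \<not> B x \<Longrightarrow> \<exists>v\<in>V. B v \<and> T x v"
begin

text \<open>The symmetry between \<open>a\<close> and \<open>b\<close>: it leaves only one of the
  two mixed types to be treated below.\<close>

lemma swap: "short_tripartite B A V W T"
  by unfold_locales
    (fact finite_V finite_W card_V
      | (rule from_a from_b to_a to_b; assumption)
      | (drule (2) to_V, argo) | (drule (2) to_W, argo)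
      | (drule (2) sep_W, argo) | (drule (2) sep_V, argo))+

text \<open>A vertex of \<open>V\<close> and one of \<open>W\<close> cannot be joined to
  \<open>a\<close> and \<open>b\<close> in the same way, since the arc between them would have no
  return. With both mixed types present in \<open>W\<close>, each vertex of \<open>V\<close> points
  to both of \<open>a\<close>, \<open>b\<close> or to neither.\<close>

lemma card_le_2_if_both_mixed:
  assumes "x \<in> W" "A x" "\<not> B x" "y \<in> W" "\<not> A y" "B y"
  shows "card W \<le> 2"
proof -
  have types: "A v = B v" if "v \<in> V" for v
    using assms that to_V to_W by blast
  \<comment> \<open>Two vertices of \<open>V\<close> of the same type would be joined alike to
    \<open>W\<close> as well, and no path of length two could lead from one to the other.\<close>
  have one0: "u = v" if "u \<in> V" "v \<in> V" "\<not> A u" "\<not> A v" for u v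
    using that types to_V sep_V by meson
  have one1: "u = v" if "u \<in> V" "v \<in> V" "A u" "A v" for u v
    using that types to_W sep_V by meson
  obtain u v where "u \<in> V" "v \<in> V" "u \<noteq> v"
    using card_V by (metis card_le_Suc0_iff_eq finite_V not_less_eq_eq numeral_2_eq_2)
  then obtain s t where st: "s \<in> V" "t \<in> V" "\<not> A s" "A t" using one0 one1 by meson
  \<comment> \<open>Since \<open>s\<close> and \<open>t\<close> occupy both unmixed types,
    \<open>W\<close> has only mixed vertices. These have the same out-neighbourhood in
    \<open>V\<close>, so only their type tells them apart.\<close>
  have "A w \<noteq> B w" if "w \<in> W" for w
    using that st types to_V to_W by blast
  moreover have "T w v = A v" if "w \<in> W" "v \<in> V" for w v
    using that types to_V to_W by blast
  ultimately have "w = w'" if "w \<in> W" "w' \<in> W" "A w = A w'" for w w'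
    using that sep_W by metis
  then have "inj_on A W" by (auto intro: inj_onI)
  then have "card W \<le> card (UNIV :: bool set)"
    by (rule card_inj_on_le) auto
  then show ?thesis by simp
qed

lemma card_le_if_mixed:
  assumes no: "\<And>y. y \<in> W \<Longrightarrow> B y \<Longrightarrow> A y" and z: "z \<in> W" "A z" "\<not> B z"
  shows "card W \<le> card V choose (card V div 2)"
proof -
  define M where "M = {x \<in> W. A x \<and> \<not> B x}"
  \<comment> \<open>The excluded type is that of \<open>z\<close>, with which such a vertex of
    \<open>V\<close> would conflict.\<close>
  have V_types: "A v \<Longrightarrow> B v" if "v \<in> V" for v
    using that z to_V to_W by blast
  have M_sep: "x = y" if "x \<in> M" "y \<in> M" "{v \<in> V. T x v} \<subseteq> {v \<in> V. T y v}" for x y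
    using that sep_W unfolding M_def by blast
  \<comment> \<open>A vertex \<open>u\<close> that all of \<open>M\<close> treats alike can be
    deleted without spoiling the antichain.\<close>
  have M_bound: "card M \<le> card (V - {u}) choose (card (V - {u}) div 2)"
    if u: "u \<in> V" "\<And>x y. x \<in> M \<Longrightarrow> y \<in> M \<Longrightarrow> T x u = T y u" for u
  proof (rule sperner_indexed[where f = "\<lambda>x. {v \<in> V - {u}. T x v}"])
    fix x y assume xy: "x \<in> M" "y \<in> M" "{v \<in> V - {u}. T x v} \<subseteq> {v \<in> V - {u}. T y v}"
    then have "{v \<in> V. T x v} \<subseteq> {v \<in> V. T y v}" using u(2)[OF xy(1,2)] by blast
    then show "x = y" using M_sep xy by blast
  qed (use finite_V in auto)
  have extra: "card W \<le> card V choose (card V div 2)"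
    if w: "w \<in> W" "W - M \<subseteq> {w}"
      and u: "u \<in> V" "\<And>x y. x \<in> M \<Longrightarrow> y \<in> M \<Longrightarrow> T x u = T y u" for w u
  proof -
    have "card W \<le> card (insert w M)"
      using that finite_W by (intro card_mono) (auto simp: M_def)
    also have "\<dots> \<le> Suc (card M)" by (rule card_insert_le_m1) auto
    also have "\<dots> \<le> Suc (card (V - {u}) choose (card (V - {u}) div 2))"
      using M_bound[OF u] by simp
    also have "\<dots> \<le> card V choose (card V div 2)"
      using Suc_central_binomial_le[OF card_V] u(1) finite_V by simp
    finally show ?thesis .
  qed
  \<comment> \<open>By \<open>no\<close>, a vertex outside \<open>M\<close> points to both of
    \<open>a\<close>, \<open>b\<close> or to neither.\<close>
  consider (source) w where "w \<in> W" "\<not> A w" "\<not> B w" | (sink) w where "w \<in> W" "A w" "B w" | "W = M"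
    using no unfolding M_def by blast
  then show ?thesis
  proof cases
    case source
    \<comment> \<open>The path from \<open>w\<close> to \<open>a\<close> passes through some
      \<open>u\<close>, which by \<open>V_types\<close> points to \<open>b\<close> too. An arc from
      \<open>u\<close> to a vertex of \<open>W\<close> would have no return, so all of
      \<open>W\<close> points to \<open>u\<close>.\<close>
    then obtain u where u: "u \<in> V" "A u" using to_a by blast
    then have "B u" using V_types by blast
    have all: "T x u" if "x \<in> W" for x using that u \<open>B u\<close> to_W by blast
    have "x = w" if "x \<in> W" "x \<notin> M" for x
    proof (rule ccontr)
      assume "x \<noteq> w"
      \<comment> \<open>Otherwise \<open>x\<close> would have the type of \<open>u\<close>. Thus
        \<open>x\<close> has the type of \<open>w\<close>, must point to all of \<open>V\<close>,
        and cannot be separated from \<open>w\<close>.\<close>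
      have "\<not> (A x \<and> B x)" using that(1) u(1) \<open>A u\<close> \<open>B u\<close> all[OF that(1)] to_V by blast
      then have "\<not> A x" "\<not> B x" using that no unfolding M_def by auto
      moreover have "T x v" if "v \<in> V" for v
        using that \<open>x \<in> W\<close> \<open>\<not> A x\<close> \<open>\<not> B x\<close> to_W by blast
      ultimately show False using sep_W[of w x] source \<open>x \<in> W\<close> \<open>x \<noteq> w\<close> by blast
    qed
    then have "W - M \<subseteq> {w}" by blast
    moreover have "T x u = T y u" if "x \<in> M" "y \<in> M" for x y
      using that all by (simp add: M_def)
    ultimately show ?thesis by (rule extra[OF source(1) _ u(1)])
  next
    case sink
    \<comment> \<open>The dual case with all arcs reversed: \<open>u\<close> is now the middle
      vertex of the path from \<open>b\<close> to \<open>w\<close>.\<close>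
    then obtain u where u: "u \<in> V" "\<not> B u" using from_b by blast
    then have "\<not> A u" using V_types by blast
    have all: "\<not> T x u" if "x \<in> W" for x using that u \<open>\<not> A u\<close> to_V by blast
    have "x = w" if "x \<in> W" "x \<notin> M" for x
    proof (rule ccontr)
      assume "x \<noteq> w"
      have "A x \<or> B x" using that(1) u(1) \<open>\<not> A u\<close> \<open>\<not> B u\<close> all[OF that(1)] to_W by blast
      then have "A x" "B x" using that no unfolding M_def by auto
      moreover have "\<not> T x v" if "v \<in> V" for v
        using that \<open>x \<in> W\<close> \<open>A x\<close> \<open>B x\<close> to_V by blast
      ultimately show False using sep_W[of x w] sink \<open>x \<in> W\<close> \<open>x \<noteq> w\<close> by blast
    qed
    then have "W - M \<subseteq> {w}" by blast
    moreover have "T x u = T y u" if "x \<in> M" "y \<in> M" for x y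
      using that all by (simp add: M_def)
    ultimately show ?thesis by (rule extra[OF sink(1) _ u(1)])
  next
    case 3
    then show ?thesis
      using sperner_indexed[of V W "\<lambda>x. {v \<in> V. T x v}"] M_sep finite_V by auto
  qed
qed

text \<open>A vertex of \<open>W\<close> that points to neither of \<open>a\<close>,
  \<open>b\<close> must point to all of \<open>V\<close>, and one that points to both must receive
  from all of \<open>V\<close>. Each of these two types occurs at most once.\<close>

lemma card_le_2_if_no_mixed:
  assumes "\<And>x. x \<in> W \<Longrightarrow> A x = B x"
  shows "card W \<le> 2"
proof -
  have "T x v = (\<not> A x)" if "x \<in> W" "v \<in> V" for x v
    using that assms to_V to_W by blast
  then have "x = y" if "x \<in> W" "y \<in> W" "A x = A y" for x y
    using that sep_W assms by metis
  then have "inj_on A W" by (auto intro: inj_onI)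
  then have "card W \<le> card (UNIV :: bool set)"
    by (rule card_inj_on_le) auto
  then show ?thesis by simp
qed

theorem card_le: "card W \<le> card V choose (card V div 2)"
proof -
  interpret s: short_tripartite B A V W T by (rule swap)
  \<comment> \<open>The central coefficient is at least 2, which covers the cases with at most two
    vertices in \<open>W\<close>.\<close>
  have "(1::nat) \<le> (card V - 1) choose ((card V - 1) div 2)"
    by (simp add: Suc_le_eq zero_less_binomial_iff)
  then have two: "2 \<le> card V choose (card V div 2)"
    using Suc_central_binomial_le[OF card_V] by linarith
  consider "\<exists>x\<in>W. A x \<and> \<not> B x" "\<exists>y\<in>W. \<not> A y \<and> B y"
    | "\<exists>x\<in>W. A x \<and> \<not> B x" "\<forall>y\<in>W. B y \<longrightarrow> A y"
    | "\<exists>x\<in>W. B x \<and> \<not> A x" "\<forall>y\<in>W. A y \<longrightarrow> B y"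
    | "\<forall>x\<in>W. A x = B x"
    by blast
  then show ?thesis
  proof cases
    case 1
    then have "card W \<le> 2" using card_le_2_if_both_mixed by blast
    then show ?thesis using two by linarith
  next
    case 2
    then show ?thesis using card_le_if_mixed by blast
  next
    case 3
    then show ?thesis using s.card_le_if_mixed by blast
  next
    case 4
    then have "card W \<le> 2" using card_le_2_if_no_mixed by blast
    then show ?thesis using two by linarith
  qed
qed

end

section \<open>Distances at most two\<close>

context pair_wf_digraph
begin

lemma awalk_cost_unit: "awalk_cost (\<lambda>_. 1) p = length p"
  by (induction p) auto

text \<open>The composition of the two reflexive closures describes the ends of walks with at most
  two arcs; \<open>u \<in> pverts G\<close> admits the empty walk.\<close>

lemma unit_distance_le_2:
  assumes "u \<in> pverts G" "(u, v) \<in> (parcs G)\<^sup>= O (parcs G)\<^sup>="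
  shows "\<mu> (\<lambda>_. 1) u v \<le> 2"
proof -
  have "\<exists>p. awalk u p v \<and> length p \<le> 2"
  proof -
    consider "u = v" | "(u, v) \<in> parcs G" | z where "(u, z) \<in> parcs G" "(z, v) \<in> parcs G"
      using assms(2) by auto
    then show ?thesis
    proof cases
      case 1
      then show ?thesis using assms(1) by (intro exI[of _ "[]"]) (simp add: awalk_def)
    next
      case 2
      then show ?thesis using assms(1) by (intro exI[of _ "[(u, v)]"]) (simp add: awalk_def)
    next
      case 3
      then show ?thesis
        using assms(1) by (intro exI[of _ "[(u, z), (z, v)]"]) (simp add: awalk_def)
    qed
  qed
  then obtain p where p: "awalk u p v" "length p \<le> 2" by blast
  have "\<mu> (\<lambda>_. 1) u v \<le> ereal (length p)"
    using min_cost_le_walk_cost[OF p(1), of "\<lambda>_. 1"] by (simp add: awalk_cost_unit)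
  also have "\<dots> \<le> ereal 2" using p(2) by simp
  finally show ?thesis by simp
qed

text \<open>A strict bound on an infimum yields a walk below it at once; as lengths are integers,
  below 3 means at most 2.\<close>

lemma two_steps_if_unit_distance_less_3:
  assumes "\<mu> (\<lambda>_. 1) u v < 3"
  shows "(u, v) \<in> (parcs G)\<^sup>= O (parcs G)\<^sup>="
proof -
  obtain p where p: "awalk u p v" "ereal (length p) < ereal 3"
    using assms by (auto simp: \<mu>_def INF_less_iff awalk_cost_unit)
  then have "length p < 3" by simp
  then consider "p = []" | e where "p = [e]" | e f where "p = [e, f]"
    by (cases p rule: list.exhaust; cases "tl p"; cases "tl (tl p)") auto
  then show ?thesis using p(1) by cases (auto simp: awalk_def)
qed

lemma unit_distance_ge_2:
  assumes "u \<noteq> v" "(u, v) \<notin> parcs G"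
  shows "2 \<le> \<mu> (\<lambda>_. 1) u v"
  unfolding \<mu>_def
proof (rule INF_greatest)
  fix p assume "p \<in> {p. awalk u p v}"
  then have "length p \<ge> 2"
    using assms by (cases p; cases "tl p") (auto simp: awalk_def)
  then have "ereal 2 \<le> ereal (length p)" by simp
  then show "2 \<le> ereal (awalk_cost (\<lambda>_. 1) p)" by (simp add: awalk_cost_unit)
qed

lemma digraph_diameter_le_2:
  assumes "\<And>u v. u \<in> pverts G \<Longrightarrow> v \<in> pverts G \<Longrightarrow> (u, v) \<in> (parcs G)\<^sup>= O (parcs G)\<^sup>="
  shows "digraph_diameter (with_proj G) \<le> 2"
  unfolding digraph_diameter_def
proof (rule SUP_least)
  fix e assume "e \<in> verts (with_proj G) \<times> verts (with_proj G)"
  then obtain u v where uv: "e = (u, v)" "u \<in> pverts G" "v \<in> pverts G" by auto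
  then show "(case e of (u, v) \<Rightarrow> \<mu> (\<lambda>_. 1) u v) \<le> 2"
    using unit_distance_le_2[OF uv(2) assms[OF uv(2,3)]] by simp
qed

lemma unit_distance_le_diameter:
  assumes "u \<in> pverts G" "v \<in> pverts G"
  shows "\<mu> (\<lambda>_. 1) u v \<le> digraph_diameter (with_proj G)"
  unfolding digraph_diameter_def
  using SUP_upper[of "(u, v)" "pverts G \<times> pverts G" "\<lambda>(u, v). \<mu> (\<lambda>_. 1) u v"] assms by simp

lemma strongly_connected_if_two_steps:
  assumes "pverts G \<noteq> {}"
    "\<And>u v. u \<in> pverts G \<Longrightarrow> v \<in> pverts G \<Longrightarrow> (u, v) \<in> (parcs G)\<^sup>= O (parcs G)\<^sup>="
  shows "strongly_connected (with_proj G)"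
proof (rule strongly_connectedI)
  fix u v assume uv: "u \<in> verts (with_proj G)" "v \<in> verts (with_proj G)"
  then consider "u = v" | "(u, v) \<in> parcs G" | z where "(u, z) \<in> parcs G" "(z, v) \<in> parcs G"
    using assms(2)[of u v] by auto
  then show "u \<rightarrow>\<^sup>*\<^bsub>with_proj G\<^esub> v"
    by cases (use uv in \<open>auto intro: reachable_trans\<close>)
qed (use assms in simp)

end

section \<open>Both directions for the complete tripartite graph\<close>

lemma orientation_of_pair_wf_digraph:
  assumes "orientation_of D G"
  shows "pair_wf_digraph D"
proof -
  interpret wf_digraph "with_proj D"
    using assms by (simp add: orientation_of_def spanning_def subgraph_def)
  show ?thesis using tail_in_verts head_in_verts by unfold_locales auto
qed

theorem theorem2p5:
  fixes p q :: nat and G :: "'a pair_pre_digraph"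
  assumes "2 \<le> p" and "p \<le> q"
    and "complete_tripartite_digraph 2 p q G"
  shows "orientation_number G = 2 \<longleftrightarrow> q \<le> p choose (p div 2)"
proof -
  obtain U V W where G: "pair_graph G" "pverts G = U \<union> V \<union> W"
    and disjoint: "U \<inter> V = {}" "U \<inter> W = {}" "V \<inter> W = {}"
    and card: "card U = 2" "card V = p" "card W = q"
    and arcs: "parcs G = U \<times> V \<union> V \<times> U \<union> U \<times> W \<union> W \<times> U \<union> V \<times> W \<union> W \<times> V"
    using assms(3) unfolding complete_tripartite_digraph_def by blast
  obtain a b where U: "U = {a, b}" "a \<noteq> b" using card(1) by (auto simp: card_2_iff)
  have fin: "finite V" "finite W" using card assms by (auto intro: card_ge_0_finite)
  have notin: "a \<notin> V" "b \<notin> V" "a \<notin> W" "b \<notin> W" using disjoint U by auto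
  have wf_G: "wf_digraph (with_proj G)"
  proof -
    interpret pair_graph G by (rule G(1))
    show ?thesis by unfold_locales
  qed
  let ?O = "{D. orientation_of D G \<and> strongly_connected (with_proj D)}"
  \<comment> \<open>The vertices \<open>a\<close> and \<open>b\<close> are not adjacent, so no
    orientation has diameter below 2.\<close>
  have ge: "2 \<le> orientation_number G"
    unfolding orientation_number_def
  proof (rule INF_greatest)
    fix D assume "D \<in> ?O"
    then have D: "orientation_of D G" by simp
    interpret pair_wf_digraph D by (rule orientation_of_pair_wf_digraph[OF D])
    have "parcs D \<subseteq> parcs G" "pverts D = pverts G"
      using D by (auto simp: orientation_of_def spanning_def subgraph_def)
    moreover have "(a, b) \<notin> parcs G" using arcs notin U by auto
    ultimately have "2 \<le> \<mu> (\<lambda>_. 1) a b" using U(2) by (intro unit_distance_ge_2) auto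
    also have "\<dots> \<le> digraph_diameter (with_proj D)"
      using \<open>pverts D = pverts G\<close> G(2) U by (intro unit_distance_le_diameter) auto
    finally show "2 \<le> digraph_diameter (with_proj D)" .
  qed
  show ?thesis
  proof
    assume "orientation_number G = 2"
    then have "orientation_number G < 3" by simp
    then obtain D where D: "orientation_of D G" and diam: "digraph_diameter (with_proj D) < 3"
      by (auto simp: orientation_number_def INF_less_iff)
    interpret pair_wf_digraph D by (rule orientation_of_pair_wf_digraph[OF D])
    define R where "R = parcs D"
    have sub: "R \<subseteq> parcs G" and verts: "pverts D = U \<union> V \<union> W"
      using D G(2) by (auto simp: orientation_of_def spanning_def subgraph_def R_def)
    have two: "(x, y) \<in> R \<or> (\<exists>z. (x, z) \<in> R \<and> (z, y) \<in> R)"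
      if "x \<in> U \<union> V \<union> W" "y \<in> U \<union> V \<union> W" "x \<noteq> y" for x y
    proof -
      have "\<mu> (\<lambda>_. 1) x y < 3"
        using unit_distance_le_diameter[of x y] diam that verts by auto
      from two_steps_if_unit_distance_less_3[OF this] that(3) show ?thesis
        by (auto simp: R_def)
    qed
    have flip: "(x, y) \<in> R \<longleftrightarrow> (y, x) \<notin> R" if "(x, y) \<in> parcs G" for x y
      using D that by (auto simp: orientation_of_def R_def)
    have flips: "(v, a) \<in> R \<longleftrightarrow> (a, v) \<notin> R" "(v, b) \<in> R \<longleftrightarrow> (b, v) \<notin> R" if "v \<in> V \<union> W" for v
      using that U arcs by (auto intro!: flip)
    have flip_VW: "(v, x) \<in> R \<longleftrightarrow> (x, v) \<notin> R" if "v \<in> V" "x \<in> W" for v x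
      using that arcs by (auto intro!: flip)
    have none: "(x, y) \<notin> R" if "x \<in> P" "y \<in> P" "P \<in> {U, V, W}" for x y P
      using that sub arcs disjoint by auto
    have inG: "x \<in> U \<union> V \<union> W" "y \<in> U \<union> V \<union> W" if "(x, y) \<in> R" for x y
      using that sub arcs by auto
    \<comment> \<open>Each locale assumption about arcs reads off a path of length at most two for
      one kind of ordered pair: between \<open>V\<close> and \<open>W\<close> against the arc,
      inside \<open>W\<close>, inside \<open>V\<close>, and between \<open>W\<close> and
      \<open>a\<close> or \<open>b\<close>.\<close>
    interpret short_tripartite "\<lambda>x. (x, a) \<in> R" "\<lambda>x. (x, b) \<in> R" V W "\<lambda>x v. (x, v) \<in> R"
    proof
      show "finite V" "finite W" "2 \<le> card V" using fin card assms by auto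
    next
      fix x v assume xv: "x \<in> W" "v \<in> V"
      have ne: "x \<noteq> v" using xv disjoint by auto
      \<comment> \<open>The middle vertex is adjacent to one vertex of \<open>V\<close> and one of
        \<open>W\<close>, and the parts are independent.\<close>
      have mid: "z \<in> U" if "(s, z) \<in> R" "(z, t) \<in> R" "(s, t) \<in> {(x, v), (v, x)}" for s t z
        using that xv none[of _ V] none[of _ W] inG by blast
      {
        assume "(x, v) \<in> R"
        then obtain z where "(v, z) \<in> R" "(z, x) \<in> R"
          using two[of v x] ne flip_VW xv by auto
        moreover from this have "z \<in> U" by (auto intro: mid)
        ultimately show "(v, a) \<in> R \<and> (x, a) \<notin> R \<or> (v, b) \<in> R \<and> (x, b) \<notin> R"
          using flips[of x] xv U by auto
      next
        assume "(x, v) \<notin> R"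
        then obtain z where "(x, z) \<in> R" "(z, v) \<in> R"
          using two[of x v] ne xv by auto
        moreover from this have "z \<in> U" by (auto intro: mid)
        ultimately show "(x, a) \<in> R \<and> (v, a) \<notin> R \<or> (x, b) \<in> R \<and> (v, b) \<notin> R"
          using flips[of v] xv U by auto
      }
    next
      fix x y assume xy: "x \<in> W" "y \<in> W" "x \<noteq> y"
      then obtain z where z: "(x, z) \<in> R" "(z, y) \<in> R" using two[of x y] none[of x W y] by auto
      then have "z = a \<or> z = b \<or> z \<in> V" using none[of x W z] inG xy U by auto
      then show "(x, a) \<in> R \<and> (y, a) \<notin> R \<or> (x, b) \<in> R \<and> (y, b) \<notin> R
          \<or> (\<exists>v\<in>V. (x, v) \<in> R \<and> (y, v) \<notin> R)"
        using z flips[of y] flip_VW xy by auto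
    next
      fix u v assume uv: "u \<in> V" "v \<in> V" "u \<noteq> v"
      then obtain z where z: "(u, z) \<in> R" "(z, v) \<in> R" using two[of u v] none[of u V v] by auto
      then have "z = a \<or> z = b \<or> z \<in> W" using none[of u V z] inG uv U by auto
      then show "(u, a) \<in> R \<and> (v, a) \<notin> R \<or> (u, b) \<in> R \<and> (v, b) \<notin> R
          \<or> (\<exists>x\<in>W. (x, u) \<notin> R \<and> (x, v) \<in> R)"
        using z flips[of v] flip_VW uv by auto
    next
      fix x assume x: "x \<in> W"
      have from_U: "\<exists>v\<in>V. (v, c) \<notin> R \<and> (x, v) \<notin> R" if c: "c \<in> U" "(x, c) \<in> R" for c
      proof -
        have "(c, x) \<notin> R" "c \<noteq> x" using flips[of x] x U c notin by auto
        then obtain z where z: "(c, z) \<in> R" "(z, x) \<in> R" using two[of c x] c x by auto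
        then have "z \<in> V" using none[of c U z] none[of z W x] inG c x by auto
        then show ?thesis using z flips[of z] flip_VW[of z x] x c U by auto
      qed
      have to_U: "\<exists>v\<in>V. (v, c) \<in> R \<and> (x, v) \<in> R" if c: "c \<in> U" "(x, c) \<notin> R" for c
      proof -
        have "c \<noteq> x" using x U c notin by auto
        then obtain z where z: "(x, z) \<in> R" "(z, c) \<in> R" using two[of x c] c x by auto
        then have "z \<in> V" using none[of z U c] none[of x W z] inG c x by auto
        then show ?thesis using z by auto
      qed
      show "(x, a) \<in> R \<Longrightarrow> \<exists>v\<in>V. (v, a) \<notin> R \<and> (x, v) \<notin> R"
        "(x, b) \<in> R \<Longrightarrow> \<exists>v\<in>V. (v, b) \<notin> R \<and> (x, v) \<notin> R"
        "(x, a) \<notin> R \<Longrightarrow> \<exists>v\<in>V. (v, a) \<in> R \<and> (x, v) \<in> R"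
        "(x, b) \<notin> R \<Longrightarrow> \<exists>v\<in>V. (v, b) \<in> R \<and> (x, v) \<in> R"
        using from_U to_U U by auto
    qed
    show "q \<le> p choose (p div 2)" using card_le card by simp
  next
    assume q: "q \<le> p choose (p div 2)"
    obtain F where F: "F \<subseteq> {S. S \<subseteq> V \<and> card S = p div 2}" "card F = q"
      and sep: "\<forall>u\<in>V. \<forall>v\<in>V. u \<noteq> v \<longrightarrow> (\<exists>S\<in>F. u \<in> S \<and> v \<notin> S)"
      using separating_middle_layer_family[OF fin(1) card(2) assms(1,2) q] by (elim exE conjE) (rule that)
    have "finite F" using F(1) fin(1) by (intro finite_subset[of F "Pow V"]) auto
    \<comment> \<open>\<open>f x\<close> is to be the out-neighbourhood of \<open>x\<close> in
      \<open>V\<close>.\<close>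
    then obtain f where f: "bij_betw f W F"
      using finite_same_card_bij[OF fin(2), of F] card F(2) by auto
    then have F_eq: "F = f ` W" by (simp add: bij_betw_def)
    have f_V: "f x \<subseteq> V" "card (f x) = p div 2" if "x \<in> W" for x
      using F(1) that unfolding F_eq by blast+
    have f_sep: "\<exists>x\<in>W. u \<in> f x \<and> v \<notin> f x" if "u \<in> V" "v \<in> V" "u \<noteq> v" for u v
      using sep that unfolding F_eq by blast
    have f_antichain: "\<exists>v. v \<in> f x \<and> v \<notin> f y" if "x \<in> W" "y \<in> W" "x \<noteq> y" for x y
    proof -
      have "f x \<noteq> f y" using f that by (auto simp: bij_betw_def inj_on_def)
      then have "\<not> f x \<subseteq> f y"
        using f_V that fin(1) card_subset_eq[of "f y" "f x"] by (metis finite_subset)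
      then show ?thesis by blast
    qed
    have f_proper: "\<exists>v. v \<in> f x" "\<exists>v\<in>V. v \<notin> f x" if "x \<in> W" for x
    proof -
      \<comment> \<open>From \<open>0 < p div 2\<close> and \<open>p div 2 < p\<close>.\<close>
      have "f x \<noteq> {}" "f x \<noteq> V" using f_V(2)[OF that] card assms by auto
      then show "\<exists>v. v \<in> f x" "\<exists>v\<in>V. v \<notin> f x" using f_V(1)[OF that] by auto
    qed
    have f_cover: "\<exists>x\<in>W. v \<in> f x" "\<exists>x\<in>W. v \<notin> f x" if v: "v \<in> V" for v
    proof -
      \<comment> \<open>Separating \<open>v\<close> from \<open>u\<close> in both orders gives one
        set that contains \<open>v\<close> and one that avoids it.\<close>
      obtain u where "u \<in> V" "u \<noteq> v"
        using card assms(1) fin v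
        by (metis card_le_Suc0_iff_eq not_less_eq_eq numeral_2_eq_2)
      then show "\<exists>x\<in>W. v \<in> f x" "\<exists>x\<in>W. v \<notin> f x" using f_sep v by blast+
    qed
    define R where "R = W \<times> {a} \<union> {a} \<times> V \<union> V \<times> {b} \<union> {b} \<times> W
      \<union> {(x, v). x \<in> W \<and> v \<in> f x} \<union> {(v, x). v \<in> V \<and> x \<in> W \<and> v \<notin> f x}"
    define D where "D = \<lparr>pverts = pverts G, parcs = R\<rparr>"
    have R_arcs: "\<And>x. x \<in> W \<Longrightarrow> (x, a) \<in> R" "\<And>v. v \<in> V \<Longrightarrow> (a, v) \<in> R"
      "\<And>v. v \<in> V \<Longrightarrow> (v, b) \<in> R" "\<And>x. x \<in> W \<Longrightarrow> (b, x) \<in> R"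
      "\<And>x v. x \<in> W \<Longrightarrow> v \<in> f x \<Longrightarrow> (x, v) \<in> R"
      "\<And>x v. x \<in> W \<Longrightarrow> v \<in> V \<Longrightarrow> v \<notin> f x \<Longrightarrow> (v, x) \<in> R"
      by (auto simp: R_def)
    have R_sub: "R \<subseteq> parcs G" using f_V(1) U arcs by (auto simp: R_def)
    interpret D: pair_wf_digraph D
      using R_sub arcs G(2) by unfold_locales (auto simp: D_def)
    have D: "orientation_of D G"
    proof -
      have "wf_digraph (with_proj D)" by unfold_locales
      moreover have "((u, v) \<in> R) \<noteq> ((v, u) \<in> R)" if "(u, v) \<in> parcs G" for u v
        using that notin U disjoint f_V(1) unfolding arcs R_def by auto
      ultimately show ?thesis
        using wf_G R_sub
        by (auto simp: orientation_of_def spanning_def subgraph_def D_def)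
    qed
    have ne: "V \<noteq> {}" "W \<noteq> {}" using card assms by auto
    have two: "(x, y) \<in> (parcs D)\<^sup>= O (parcs D)\<^sup>=" if "x \<in> pverts D" "y \<in> pverts D" for x y
    proof -
      have "x = y \<or> (x, y) \<in> R \<or> (\<exists>z. (x, z) \<in> R \<and> (z, y) \<in> R)"
      proof -
        have verts: "pverts D = {a, b} \<union> V \<union> W" using G(2) U by (simp add: D_def)
        have y: "y = a \<or> y = b \<or> y \<in> V \<or> y \<in> W" using that(2) verts by auto
        have "x = a \<or> x = b \<or> x \<in> V \<or> x \<in> W" using that(1) verts by auto
        \<comment> \<open>Paths along the cycle of parts serve \<open>a\<close> to \<open>b\<close>,
          \<open>b\<close> to \<open>a\<close>, \<open>V\<close> to \<open>W\<close> and
          \<open>W\<close> to \<open>V\<close>. The others use \<open>f\<close>: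
          \<open>f_proper\<close> for \<open>a\<close> to \<open>W\<close> and \<open>W\<close> to
          \<open>b\<close>, \<open>f_cover\<close> for \<open>b\<close> to \<open>V\<close> and
          \<open>V\<close> to \<open>a\<close>, \<open>f_sep\<close> inside \<open>V\<close> and
          \<open>f_antichain\<close> inside \<open>W\<close>.\<close>
        then consider "x = a" | "x = b" | "x \<in> V" | "x \<in> W" by blast
        then show ?thesis
        proof cases
          case x: 1
          from y show ?thesis
          proof (elim disjE)
            assume "y = a"
            then show ?thesis using x by simp
          next
            assume "y = b"
            then show ?thesis using x R_arcs(2,3) ne(1) by blast
          next
            assume "y \<in> V"
            then show ?thesis using x R_arcs(2) by simp
          next
            assume "y \<in> W"
            then show ?thesis using x R_arcs(2,6) f_proper(2) by blast
          qed
        next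
          case x: 2
          from y show ?thesis
          proof (elim disjE)
            assume "y = a"
            then show ?thesis using x R_arcs(1,4) ne(2) by blast
          next
            assume "y = b"
            then show ?thesis using x by simp
          next
            assume "y \<in> V"
            then show ?thesis using x R_arcs(4,5) f_cover(1) by blast
          next
            assume "y \<in> W"
            then show ?thesis using x R_arcs(4) by simp
          qed
        next
          case x: 3
          from y show ?thesis
          proof (elim disjE)
            assume "y = a"
            then show ?thesis using x R_arcs(1,6) f_cover(2) by blast
          next
            assume "y = b"
            then show ?thesis using x R_arcs(3) by blast
          next
            assume "y \<in> V"
            then show ?thesis using x R_arcs(5,6) f_sep by metis
          next
            assume "y \<in> W"
            then show ?thesis using x R_arcs(3,4) by blast
          qed
        next
          case x: 4
          from y show ?thesis
          proof (elim disjE)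
            assume "y = a"
            then show ?thesis using x R_arcs(1) by blast
          next
            assume "y = b"
            then show ?thesis using x R_arcs(3,5) f_V(1) f_proper(1) by blast
          next
            assume "y \<in> V"
            then show ?thesis using x R_arcs(1,2) by blast
          next
            assume "y \<in> W"
            then show ?thesis using x R_arcs(5,6) f_V(1) f_antichain by (metis subsetD)
          qed
        qed
      qed
      then show ?thesis by (auto simp: D_def)
    qed
    have "strongly_connected (with_proj D)"
      using D.strongly_connected_if_two_steps[OF _ two] G(2) U by (auto simp: D_def)
    then have "orientation_number G \<le> digraph_diameter (with_proj D)"
      using D unfolding orientation_number_def by (intro INF_lower) auto
    also have "\<dots> \<le> 2" by (rule D.digraph_diameter_le_2[OF two])
    finally show "orientation_number G = 2" using ge by (rule antisym)
  qed
qed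

end
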